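(* Let $\xi \in \mathbb{C}^{\times}$ and let $\lambda \in \mathbb{C}[T] \setminus \mathbb{C}$ be a non-constant polynomial. Let $$F(X,Y) = X(X-Y)(X+Y)(X-\lambda Y) + Y^4 = X^4 - \lambda X^3 Y - X^2 Y^2 + \lambda X Y^3 + Y^4 \in \mathbb{C}[T][X,Y].$$ Then the set of all $(x,y) \in \mathbb{C}[T] \times \mathbb{C}[T]$ with $F(x,y) = \xi$ is exactly $$\mathcal{S} = \{(\zeta, 0),\ (0, \zeta),\ (\zeta, \zeta),\ (-\zeta, \zeta),\ (\zeta \lambda, \zeta),\ (-\zeta, \zeta \lambda) \;:\; \zeta \in \mathbb{C}^{\times},\ \zeta^4 = \xi\}.$$
   Context: $\mathbb{C}[T]$ is the polynomial ring in one variable $T$ over the complex numbers; $\mathbb{C}$ is regarded as the subring of constant polynomials, and $\mathbb{C}^{\times} = \mathbb{C} \setminus \{0\}$. *)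

theory Defs
  imports Complex_Main "HOL-Computational_Algebra.Computational_Algebra"
begin

(* The value F(x,y) in C[T] of the binary quartic form F in C[T][X,Y] with parameter lam in C[T]. *)
definition F :: "complex poly \<Rightarrow> complex poly \<Rightarrow> complex poly \<Rightarrow> complex poly" where
  "F lam x y = x * (x - y) * (x + y) * (x - lam * y) + y ^ 4"

lemma F_expand:
  "F lam x y = x ^ 4 - lam * x ^ 3 * y - x ^ 2 * y ^ 2 + lam * x * y ^ 3 + y ^ 4"
  by (simp add: F_def algebra_simps power2_eq_square power3_eq_cube power4_eq_xxxx)

end

theory Submission
  imports Defs "HOL-Computational_Algebra.Field_as_Ring"
begin

text \<open>
  With \<open>u = x\<^sup>2 - y\<^sup>2\<close> and \<open>v = x y\<close> the quartic form becomes \<open>u\<^sup>2 - \<lambda> u v + v\<^sup>2\<close>, so the equation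
  turns into a Pell equation. Descent on degrees (Vieta jumping) shows that its solutions are, up to
  a constant \<open>\<eta>\<close> with \<open>\<eta>\<^sup>2 = \<xi>\<close> and order, consecutive terms of the recurrence
  \<open>S\<^sub>0 = 0\<close>, \<open>S\<^sub>1 = 1\<close>, \<open>S\<^sub>n\<^sub>+\<^sub>2 = \<lambda> S\<^sub>n\<^sub>+\<^sub>1 - S\<^sub>n\<close>. Moreover \<open>u \<plusminus> 2 i v = (x \<plusminus> i y)\<^sup>2\<close> are squares, so
  \<open>S\<^sub>n\<^sub>+\<^sub>1 \<plusminus> c S\<^sub>n\<close> are squares up to constants for a constant \<open>c\<close>, which is \<open>2 i\<close> or \<open>- i / 2\<close>.
  The square roots divide the derivatives, and the differential equations satisfied by \<open>S\<^sub>n\<close>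
  then force their product, of degree \<open>n deg \<lambda>\<close>, to divide a nonzero multiple of \<open>\<lambda>'\<close> of degree at
  most \<open>3 deg \<lambda> - 1\<close>. Hence \<open>n \<le> 2\<close>, and these cases are treated by hand.
\<close>

section \<open>Chebyshev recurrence: norm form, derivatives, degrees\<close>

text \<open>In terms of Chebyshev polynomials of the second kind, \<open>cheb l (Suc n)\<close> is
  U_n evaluated at l / 2.\<close>

fun cheb :: "'a::comm_ring_1 \<Rightarrow> nat \<Rightarrow> 'a" where
  "cheb l 0 = 0"
| "cheb l (Suc 0) = 1"
| "cheb l (Suc (Suc n)) = l * cheb l (Suc n) - cheb l n"

text \<open>The quadratic form is invariant under the recurrence step (u, v) -> (l u - v, u). The
  value 1 also makes consecutive terms coprime.\<close>

lemma cheb_norm: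
  "cheb l (Suc n) ^ 2 - l * cheb l (Suc n) * cheb l n + cheb l n ^ 2 = 1"
proof (induction n)
  case (Suc n)
  then show ?case
    by (simp add: power2_eq_square algebra_simps)
qed simp

text \<open>The two identities are proved together: the first at \<open>Suc n\<close> is the second
  at \<open>n\<close> rewritten by the recurrence, and the second at \<open>Suc n\<close> comes from
  differentiating the recurrence and using both.\<close>

lemma pderiv_cheb:
  fixes l :: "'a::idom poly"
  shows "(l ^ 2 - 4) * pderiv (cheb l n) =
      pderiv l * (2 * of_nat n * cheb l (Suc n) - (of_nat n + 1) * l * cheb l n)"
    and "(l ^ 2 - 4) * pderiv (cheb l (Suc n)) =
      pderiv l * (of_nat n * l * cheb l (Suc n) - 2 * (of_nat n + 1) * cheb l n)"
proof (induction n)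
  case (Suc n)
  let ?u = "cheb l (Suc n)" and ?v = "cheb l n"
  show "(l ^ 2 - 4) * pderiv (cheb l (Suc n)) =
      pderiv l * (2 * of_nat (Suc n) * cheb l (Suc (Suc n)) - (of_nat (Suc n) + 1) * l * cheb l (Suc n))"
    unfolding Suc.IH(2) by (simp add: algebra_simps)
  have "(l ^ 2 - 4) * pderiv (cheb l (Suc (Suc n))) =
      (l ^ 2 - 4) * pderiv l * ?u + l * ((l ^ 2 - 4) * pderiv ?u) - (l ^ 2 - 4) * pderiv ?v"
    by (simp add: pderiv_diff pderiv_mult algebra_simps)
  also have "\<dots> = pderiv l * (of_nat (Suc n) * l * cheb l (Suc (Suc n)) -
      2 * (of_nat (Suc n) + 1) * cheb l (Suc n))"
    unfolding Suc.IH by (simp add: algebra_simps power2_eq_square)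
  finally show "(l ^ 2 - 4) * pderiv (cheb l (Suc (Suc n))) = \<dots>" .
qed simp_all

lemma degree_cheb:
  fixes l :: "'a::idom poly"
  assumes "degree l > 0"
  shows "cheb l (Suc n) \<noteq> 0 \<and> degree (cheb l (Suc n)) = n * degree l"
  using assms
proof (induction l n rule: cheb.induct)
  case (3 l n)
  have "degree (l * cheb l (Suc (Suc n))) = Suc (Suc n) * degree l"
    using 3 by (subst degree_mult_eq) auto
  moreover from this have "degree (l * cheb l (Suc (Suc n)) - cheb l (Suc n)) = \<dots>"
    using 3 by (subst diff_conv_add_uminus, subst degree_add_eq_left) auto
  ultimately show ?case
    using 3(3) unfolding cheb.simps(3)[of l "Suc n"] by (metis degree_0 less_numeral_extra(3) mult_is_0 nat.distinct(1))
qed auto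

lemma degree_cheb_add:
  fixes l :: "'a::idom poly"
  assumes "degree l > 0"
  shows "degree (cheb l (Suc n) + [:c:] * cheb l n) = n * degree l"
proof (cases n)
  case (Suc m)
  have "degree ([:c:] * cheb l n) \<le> m * degree l"
    using degree_cheb[OF assms, of m] Suc degree_mult_le[of "[:c:]" "cheb l n"] by simp
  then show ?thesis
    using degree_cheb[OF assms, of n] Suc assms by (simp del: cheb.simps add: degree_add_eq_left)
qed simp

section \<open>Square values and the bound on the index\<close>

text \<open>A square root \<open>p\<close> of a constant multiple of \<open>P\<close> divides both
  \<open>P\<close> and its derivative. Modulo \<open>P\<close> the differential equations leave only
  a multiple of \<open>cheb l n\<close>, which is coprime to \<open>p\<close> and cancels.\<close>

lemma sqrt_dvd_pderiv_cheb:
  fixes l p :: "complex poly"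
  assumes p: "p ^ 2 = [:k:] * (cheb l (Suc n) + [:c:] * cheb l n)" and k: "k \<noteq> 0"
  shows "p dvd pderiv l * ([:c * (2 * of_nat n + 1):] * l + [:2 * of_nat n * c ^ 2 + 2 * of_nat n + 2:])"
proof -
  let ?u = "cheb l (Suc n)" and ?v = "cheb l n"
  define P where "P = ?u + [:c:] * ?v"
  define L where "L = [:c * (2 * of_nat n + 1):] * l + [:2 * of_nat n * c ^ 2 + 2 * of_nat n + 2:]"
  define C where "C = [:c:]"
  define N :: "complex poly" where "N = of_nat n"
  have P: "P = smult (1 / k) (p ^ 2)"
    using p k by (simp add: P_def)
  have pP: "p dvd P"
    unfolding P by (simp add: dvd_smult power2_eq_square)
  have "pderiv P = smult (1 / k) (2 * p * pderiv p)"
    unfolding P by (simp add: pderiv_smult power2_eq_square pderiv_mult mult.assoc)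
  then have pP': "p dvd pderiv P"
    by (simp add: dvd_smult)
  have L: "L = C * (2 * N + 1) * l + 2 * N * C ^ 2 + 2 * N + 2"
    by (simp add: L_def C_def N_def of_nat_poly numeral_poly one_pCons power2_eq_square algebra_simps)
  have "pderiv P = pderiv ?u + C * pderiv ?v"
    by (simp add: P_def pderiv_add pderiv_smult C_def)
  then have "(l ^ 2 - 4) * pderiv P = (l ^ 2 - 4) * pderiv ?u + C * ((l ^ 2 - 4) * pderiv ?v)"
    by (simp add: algebra_simps)
  \<comment> \<open>Substituting \<open>?u = P - C * ?v\<close> eliminates \<open>?u\<close>; the
    remaining coefficient of \<open>?v\<close> is \<open>- L\<close>.\<close>
  also have "\<dots> = pderiv l * ((N * l + 2 * N * C) * P - L * ?v)"
    unfolding pderiv_cheb(1)[of _ n] pderiv_cheb(2) L P_def C_def[symmetric] N_def[symmetric]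
    by (simp add: algebra_simps power2_eq_square)
  finally have "pderiv l * L * ?v = pderiv l * (N * l + 2 * N * C) * P - (l ^ 2 - 4) * pderiv P"
    by (simp add: algebra_simps)
  then have dvd: "p dvd pderiv l * L * ?v"
    using pP pP' by simp
  have "coprime p ?v"
  proof (rule coprimeI)
    fix r assume r: "r dvd p" "r dvd ?v"
    then have "r dvd P - C * ?v"
      using pP by (meson dvd_diff dvd_mult dvd_trans)
    then have "r dvd ?u"
      by (simp add: P_def C_def)
    then have "r dvd ?u ^ 2 - l * ?u * ?v + ?v ^ 2"
      using r by (simp add: power2_eq_square)
    then show "r dvd 1"
      unfolding cheb_norm .
  qed
  then show ?thesis
    using dvd coprime_dvd_mult_left_iff unfolding L_def by blast
qed

text \<open>One square alone would only give n \<le> 3. Since \<open>p\<close> and \<open>q\<close>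
  are coprime, their product divides \<open>pderiv l * (L c * L (- c))\<close>, and comparing
  degrees gives n < 3.\<close>

lemma cheb_both_squares:
  fixes l p q :: "complex poly"
  assumes l: "degree l > 0" and c: "c \<noteq> 0" and k: "k \<noteq> 0"
    and p: "p ^ 2 = [:k:] * (cheb l (Suc n) + [:c:] * cheb l n)"
    and q: "q ^ 2 = [:k:] * (cheb l (Suc n) + [:- c:] * cheb l n)"
  shows "n \<le> 2"
proof -
  let ?u = "cheb l (Suc n)" and ?v = "cheb l n"
  define L where "L c = [:c * (2 * of_nat n + 1):] * l + [:2 * of_nat n * c ^ 2 + 2 * of_nat n + 2:]"
    for c :: complex
  have degL: "degree (L c) = degree l" if "c \<noteq> 0" for c
  proof -
    have "1 + 2 * of_nat n \<noteq> (0::complex)"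
      by (metis of_nat_1 of_nat_add of_nat_mult of_nat_numeral of_nat_eq_0_iff add_is_0 one_neq_zero)
    then have "degree (smult (c * (2 * of_nat n + 1)) l) = degree l"
      using that by (simp add: add.commute)
    then show ?thesis
      using l by (simp add: L_def degree_add_eq_left)
  qed
  have "coprime p q"
  proof (rule coprimeI)
    fix r assume r: "r dvd p" "r dvd q"
    then have "r dvd p ^ 2" "r dvd q ^ 2"
      by (simp_all add: power2_eq_square)
    then have "r dvd ?u + [:c:] * ?v" "r dvd ?u + [:- c:] * ?v"
      using k unfolding p q by (simp_all add: dvd_smult_iff)
    then have "r dvd (?u + [:c:] * ?v) + (?u + [:- c:] * ?v)" "r dvd (?u + [:c:] * ?v) - (?u + [:- c:] * ?v)"
      by (rule dvd_add, rule dvd_diff)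
    moreover have "(?u + [:c:] * ?v) + (?u + [:- c:] * ?v) = smult 2 ?u"
      "(?u + [:c:] * ?v) - (?u + [:- c:] * ?v) = smult (2 * c) ?v"
      by (simp_all add: numeral_poly mult_2[symmetric] mult.commute[of 2 c] flip: smult_smult)
    ultimately have "r dvd smult 2 ?u" "r dvd smult (2 * c) ?v"
      by (simp_all only:)
    then have "r dvd ?u" "r dvd ?v"
      using c by (auto dest: dvd_smult_cancel)
    then have "r dvd ?u ^ 2 - l * ?u * ?v + ?v ^ 2"
      by (simp add: power2_eq_square)
    then show "r dvd 1"
      unfolding cheb_norm .
  qed
  moreover have "p dvd pderiv l * (L c * L (- c))"
    using dvd_mult2[OF sqrt_dvd_pderiv_cheb[OF p k, folded L_def], of "L (- c)"] by (simp only: mult.assoc)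
  moreover have "q dvd pderiv l * (L c * L (- c))"
    using dvd_mult2[OF sqrt_dvd_pderiv_cheb[OF q k, folded L_def], of "L c"]
    by (simp only: mult.assoc mult.commute[of "L (- c)"])
  ultimately have pq: "p * q dvd pderiv l * (L c * L (- c))"
    using divides_mult by blast
  have nz: "pderiv l \<noteq> 0" "L c \<noteq> 0" "L (- c) \<noteq> 0"
    using l degL[of c] degL[of "- c"] c by (auto simp: pderiv_eq_0_iff)
  have deg: "2 * degree r = n * degree l" if "r ^ 2 = [:k:] * (?u + [:c:] * ?v)" for r c
  proof -
    have "2 * degree r = degree (r ^ 2)"
      by (cases "r = 0") (simp_all add: degree_power_eq)
    also have "\<dots> = n * degree l"
      unfolding that using k degree_cheb_add[OF l, of n c] by simp
    finally show ?thesis .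
  qed
  show ?thesis
  proof (cases "p = 0 \<or> q = 0")
    case True
    \<comment> \<open>As \<open>degree 0 = 0\<close>, the degree formula also covers a zero root and
      yields n = 0.\<close>
    then show ?thesis
      using deg[OF p] deg[OF q] l by auto
  next
    case False
    have "n * degree l = degree (p * q)"
      using False deg[OF p] deg[OF q] by (simp add: degree_mult_eq)
    also have "\<dots> \<le> degree (pderiv l * (L c * L (- c)))"
      using pq nz by (intro dvd_imp_degree_le) auto
    also have "\<dots> = degree l - 1 + 2 * degree l"
      using nz degL c by (simp add: degree_mult_eq degree_pderiv)
    also have "\<dots> < 3 * degree l"
      using l by simp
    finally show ?thesis
      by simp
  qed
qed

section \<open>The Pell equation by descent\<close>

lemma sqrt_const_poly:
  fixes r :: "complex poly"
  assumes "r ^ 2 = [:a:]"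
  obtains b where "r = [:b:]" "b ^ 2 = a"
proof -
  have "2 * degree r = 0"
    using assms by (cases "r = 0") (simp_all add: degree_power_eq[symmetric])
  then obtain b where "r = [:b:]"
    by (auto elim: degree_eq_zeroE)
  with that assms show thesis
    by (simp add: power2_eq_square)
qed

text \<open>For fixed \<open>v\<close> the equation is quadratic in \<open>u\<close>, with second
  root \<open>w = l * v - u\<close>. If \<open>v\<close> is non-constant, (v, w) is a solution of
  smaller degree, and the recurrence leads back from it to (u, v). The case \<open>u = 0\<close> is
  listed separately because \<open>degree 0 = 0\<close> lets it pass the degree hypothesis.\<close>

lemma pell_solutions:
  fixes l u v :: "complex poly"
  assumes l: "degree l > 0"
    and eq: "u ^ 2 - l * u * v + v ^ 2 = [:\<xi>:]" and le: "degree v \<le> degree u"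
  shows "\<exists>\<eta>. \<eta> ^ 2 = \<xi> \<and>
    ((u = 0 \<and> v = [:\<eta>:]) \<or> (\<exists>n. u = [:\<eta>:] * cheb l (Suc n) \<and> v = [:\<eta>:] * cheb l n))"
  using eq le
proof (induction "degree v" arbitrary: u v rule: less_induct)
  case less
  define w where "w = l * v - u"
  have uw: "u * w = v ^ 2 - [:\<xi>:]"
    unfolding less.prems(1)[symmetric] w_def by (simp add: algebra_simps power2_eq_square)
  have sqrt: "\<exists>\<eta>. r = [:\<eta>:] \<and> \<eta> ^ 2 = \<xi>" if "r ^ 2 = [:\<xi>:]" for r
    using sqrt_const_poly[OF that] by blast
  consider "v = 0" | "v \<noteq> 0" "degree v = 0" | "degree v > 0"
    by auto
  then show ?case
  proof cases
    case 1
    then show ?thesis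
      using sqrt[of u] less.prems(1) by (auto intro!: exI[of _ "0::nat"])
  next
    case 2
    \<comment> \<open>Otherwise \<open>u\<close> and \<open>w\<close> would both be constant, but
      their sum \<open>l * v\<close> is not.\<close>
    have "u * w = 0"
    proof (rule ccontr)
      assume nz: "u * w \<noteq> 0"
      have "degree (v ^ 2) = 0"
        using 2 by (simp add: degree_power_eq)
      then have "degree (u * w) = 0"
        unfolding uw using degree_diff_le_max[of "v ^ 2" "[:\<xi>:]"] by simp
      then have "degree u = 0" "degree w = 0"
        using nz by (auto simp: degree_mult_eq)
      then have "degree (u + w) = 0"
        using degree_add_le_max[of u w] by simp
      moreover have "degree (l * v) = degree l"
        using 2 l by (subst degree_mult_eq) auto
      ultimately show False
        using l by (simp add: w_def)
    qed
    then obtain \<eta> where "v = [:\<eta>:]" "\<eta> ^ 2 = \<xi>"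
      using sqrt[of v] uw by auto
    moreover have "u = 0 \<or> u = l * v"
      using \<open>u * w = 0\<close> by (auto simp: w_def)
    ultimately show ?thesis
      by (auto intro!: exI[of _ \<eta>] exI[of _ "Suc 0"])
  next
    case 3
    have "v \<noteq> 0"
      using 3 by auto
    then have d: "degree (v ^ 2 - [:\<xi>:]) = 2 * degree v"
      using 3 by (subst diff_conv_add_uminus, subst degree_add_eq_left) (auto simp: degree_power_eq)
    then have nz: "u \<noteq> 0" "w \<noteq> 0"
      using 3 uw by auto
    then have uwd: "degree u + degree w = 2 * degree v"
      using d by (simp add: uw[symmetric] degree_mult_eq)
    \<comment> \<open>Otherwise \<open>u\<close>, \<open>v\<close> and \<open>w\<close> would have
      equal degree, too small for \<open>u + w = l * v\<close>.\<close>
    have "degree w < degree v"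
    proof (rule ccontr)
      assume "\<not> degree w < degree v"
      then have "degree u = degree v" "degree w = degree v"
        using uwd less.prems(2) by auto
      then have "degree (u + w) \<le> degree v"
        using degree_add_le_max[of u w] by simp
      moreover have "degree (l * v) = degree l + degree v"
        using 3 l by (subst degree_mult_eq) auto
      ultimately show False
        using l by (simp add: w_def)
    qed
    moreover have "v ^ 2 - l * v * w + w ^ 2 = [:\<xi>:]"
      unfolding less.prems(1)[symmetric] w_def by (simp add: algebra_simps power2_eq_square)
    ultimately obtain \<eta> where \<eta>: "\<eta> ^ 2 = \<xi>"
      "(v = 0 \<and> w = [:\<eta>:]) \<or> (\<exists>n. v = [:\<eta>:] * cheb l (Suc n) \<and> w = [:\<eta>:] * cheb l n)"
      using less.hyps[of w v] by auto
    then obtain n where n: "v = [:\<eta>:] * cheb l (Suc n)" "w = [:\<eta>:] * cheb l n"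
      using 3 by auto
    have "u = l * v - w"
      by (simp add: w_def)
    also have "\<dots> = [:\<eta>:] * cheb l (Suc (Suc n))"
      unfolding n by (simp add: algebra_simps smult_diff_right)
    finally show ?thesis
      using \<eta>(1) n(1) by blast
  qed
qed

lemma mult_eq_const:
  fixes p q :: "'a::idom poly"
  assumes "p * q = [:a:]" and "a \<noteq> 0"
  shows "degree p = 0" and "degree q = 0"
proof -
  have "p \<noteq> 0" "q \<noteq> 0"
    using assms by auto
  then have "degree p + degree q = 0"
    using assms(1) by (simp add: degree_mult_eq[symmetric])
  then show "degree p = 0" and "degree q = 0"
    by auto
qed

text \<open>The factors \<open>p + q\<close> and \<open>p - q\<close> are constant, and they
  determine \<open>p\<close> and \<open>q\<close>.\<close>

lemma diff_squares_eq_const: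
  fixes p q :: "complex poly"
  assumes "p ^ 2 - q ^ 2 = [:a:]" and "a \<noteq> 0"
  shows "degree p = 0" and "degree q = 0"
proof -
  have "(p + q) * (p - q) = [:a:]"
    using assms(1) by (simp add: algebra_simps power2_eq_square)
  from mult_eq_const[OF this assms(2)] obtain b c where "p + q = [:b:]" "p - q = [:c:]"
    by (auto elim!: degree_eq_zeroE)
  moreover have "smult 2 p = (p + q) + (p - q)" "smult 2 q = (p + q) - (p - q)"
    by (simp_all add: numeral_poly flip: mult_2)
  ultimately have "smult 2 p = [:b + c:]" "smult 2 q = [:b - c:]"
    by simp_all
  then show "degree p = 0" and "degree q = 0"
    by (metis degree_pCons_0 degree_smult_eq zero_neq_numeral)+
qed

section \<open>From Pell solutions back to x and y\<close>

definition solutions :: "complex poly \<Rightarrow> complex \<Rightarrow> (complex poly \<times> complex poly) set" where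
  "solutions l \<zeta> = {([:\<zeta>:], 0), (0, [:\<zeta>:]), ([:\<zeta>:], [:\<zeta>:]), (- [:\<zeta>:], [:\<zeta>:]),
       ([:\<zeta>:] * l, [:\<zeta>:]), (- [:\<zeta>:], [:\<zeta>:] * l)}"

lemma F_eq_pell:
  "F l x y = (x ^ 2 - y ^ 2) ^ 2 - l * (x ^ 2 - y ^ 2) * (x * y) + (x * y) ^ 2"
  unfolding F_def by algebra

text \<open>The squares of x + i y and x - i y bound \<open>n\<close> by 2. Then n = 0 gives the
  pairs with a zero entry, n = 1 gives none, and n = 2 gives the pairs involving
  \<open>l\<close>.\<close>

lemma solutions_larger_first:
  fixes l x y :: "complex poly"
  assumes l: "degree l > 0" and \<eta>: "\<eta> \<noteq> 0"
    and u: "x ^ 2 - y ^ 2 = [:\<eta>:] * cheb l (Suc n)" and v: "x * y = [:\<eta>:] * cheb l n"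
  shows "\<exists>\<zeta>. \<zeta> ^ 4 = \<eta> ^ 2 \<and> (x, y) \<in> solutions l \<zeta>"
proof -
  define J where "J = [:\<i>:]"
  have J2: "J * J = -1" and J: "[:2 * \<i>:] = 2 * J" "[:- (2 * \<i>):] = - (2 * J)"
    by (simp_all add: J_def numeral_poly one_pCons)
  have "(x + J * y) ^ 2 = (x ^ 2 - y ^ 2) + 2 * J * (x * y)"
    and "(x - J * y) ^ 2 = (x ^ 2 - y ^ 2) - 2 * J * (x * y)"
    using J2 by algebra+
  then have "(x + J * y) ^ 2 = [:\<eta>:] * (cheb l (Suc n) + [:2 * \<i>:] * cheb l n)"
    and "(x - J * y) ^ 2 = [:\<eta>:] * (cheb l (Suc n) + [:- (2 * \<i>):] * cheb l n)"
    unfolding u v J by algebra+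
  then have "n \<le> 2"
    using cheb_both_squares[OF l _ \<eta>, of "2 * \<i>"] by simp
  then consider "n = 0" | "n = 1" | "n = 2"
    by linarith
  then show ?thesis
  proof cases
    case 1
    then have xy: "x ^ 2 - y ^ 2 = [:\<eta>:]" "x = 0 \<or> y = 0"
      using u v by auto
    show ?thesis
    proof (cases "y = 0")
      case True
      with xy obtain b where "x = [:b:]" "b ^ 2 = \<eta>"
        using sqrt_const_poly[of x \<eta>] by auto
      with True show ?thesis
        by (intro exI[of _ b]) (auto simp: solutions_def)
    next
      case False
      with xy have x: "x = 0" and "y ^ 2 = [:- \<eta>:]"
        by (auto simp: minus_equation_iff)
      then obtain b where b: "y = [:b:]" "b ^ 2 = - \<eta>"
        using sqrt_const_poly by metis
      \<comment> \<open>Only the fourth power of \<open>b\<close> matters, so both signs of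
        \<open>\<eta>\<close> are admissible.\<close>
      have "b ^ 4 = \<eta> ^ 2"
        using b(2) by algebra
      with x b show ?thesis
        by (intro exI[of _ b]) (auto simp: solutions_def)
    qed
  next
    case 2
    then have "x * y = [:\<eta>:]"
      using v by simp
    from mult_eq_const[OF this \<eta>] have "degree (x ^ 2 - y ^ 2) = 0"
      by (auto elim!: degree_eq_zeroE simp: power2_eq_square)
    then show ?thesis
      using 2 l \<eta> unfolding u by simp
  next
    case 3
    define H where "H = [:\<eta>:]"
    have u': "x ^ 2 - y ^ 2 = H * (l ^ 2 - 1)" and v': "x * y = H * l"
      using u v 3 by (simp_all add: H_def numeral_2_eq_2 power2_eq_square)
    \<comment> \<open>Multiplying \<open>u'\<close> by \<open>x ^ 2\<close> and eliminating
      \<open>y\<close> through \<open>v'\<close> gives a quadratic in \<open>x ^ 2\<close> that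
      splits.\<close>
    have "(x ^ 2 - H * l ^ 2) * (x ^ 2 + H) = 0"
      using u' v' by algebra
    then consider "x ^ 2 = H * l ^ 2" | "x ^ 2 = - H"
      by (auto simp: eq_neg_iff_add_eq_0)
    then show ?thesis
    proof cases
      case 1
      then have "y ^ 2 = [:\<eta>:]"
        using u' unfolding H_def[symmetric] by algebra
      then obtain b where b: "y = [:b:]" "b ^ 2 = \<eta>"
        using sqrt_const_poly by metis
      have "H = y ^ 2"
        using \<open>y ^ 2 = [:\<eta>:]\<close> by (simp add: H_def)
      then have "y * (x - y * l) = 0"
        using v' by algebra
      then have "x = y * l"
        using b \<eta> by auto
      with b show ?thesis
        by (intro exI[of _ b]) (auto simp: solutions_def)
    next
      case 2
      then have "(- x) ^ 2 = [:- \<eta>:]"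
        by (simp add: H_def)
      then obtain b where b: "- x = [:b:]" "b ^ 2 = - \<eta>"
        using sqrt_const_poly by metis
      have "x * (y + x * l) = 0"
        using v' 2 by algebra
      moreover have "x \<noteq> 0"
        using b \<eta> by auto
      ultimately have "y + x * l = 0"
        by simp
      then have "x = - [:b:]" "y = [:b:] * l"
        unfolding b(1)[symmetric] by (simp_all add: eq_neg_iff_add_eq_0)
      moreover have "b ^ 4 = \<eta> ^ 2"
        using b(2) by algebra
      ultimately show ?thesis
        using b(1) by (intro exI[of _ b]) (auto simp: solutions_def)
    qed
  qed
qed

text \<open>Now the product x y has the larger index, and dividing u + 2 i v by 2 i turns the
  constant into - i / 2. Here n = 0 gives x = y or x = - y, while n = 1 and n = 2 give
  nothing.\<close>

lemma solutions_larger_second: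
  fixes l x y :: "complex poly"
  assumes l: "degree l > 0" and \<eta>: "\<eta> \<noteq> 0"
    and u: "x ^ 2 - y ^ 2 = [:\<eta>:] * cheb l n" and v: "x * y = [:\<eta>:] * cheb l (Suc n)"
  shows "\<exists>\<zeta>. \<zeta> ^ 4 = \<eta> ^ 2 \<and> (x, y) \<in> solutions l \<zeta>"
proof -
  define J where "J = [:\<i>:]"
  define K where "K = [:- (\<i> / 2):]"
  define H where "H = [:\<eta>:]"
  have J2: "J * J = -1" and K: "2 * K = - J" and J: "[:2 * \<i> * \<eta>:] = 2 * J * H" "[:- (- (\<i> / 2)):] = - K"
    by (simp_all add: J_def K_def H_def numeral_poly one_pCons)
  have p: "(x + J * y) ^ 2 = [:2 * \<i> * \<eta>:] * (cheb l (Suc n) + K * cheb l n)"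
    using J2 K u v unfolding J H_def[symmetric] by algebra
  \<comment> \<open>Here \<open>J * x + y\<close> is i times x - i y; the factor i flips the sign of
    the square, so that both squares share the constant 2 i \<eta>.\<close>
  moreover have "(J * x + y) ^ 2 = [:2 * \<i> * \<eta>:] * (cheb l (Suc n) + [:- (- (\<i> / 2)):] * cheb l n)"
    using J2 K u v unfolding J H_def[symmetric] by algebra
  ultimately have "n \<le> 2"
    using cheb_both_squares[OF l, of "- (\<i> / 2)" "2 * \<i> * \<eta>"] \<eta> by (simp add: K_def)
  then consider "n = 0" | "n = 1" | "n = 2"
    by linarith
  then show ?thesis
  proof cases
    case 1
    then have v': "x * y = [:\<eta>:]" and "(x - y) * (x + y) = 0"
      using u v by (simp_all add: algebra_simps power2_eq_square)
    then consider "x = y" | "x = - y"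
      by (auto simp: eq_neg_iff_add_eq_0)
    then show ?thesis
    proof cases
      case 1
      then have "y ^ 2 = [:\<eta>:]"
        using v' by (simp add: power2_eq_square)
      then obtain b where "y = [:b:]" "b ^ 2 = \<eta>"
        using sqrt_const_poly by metis
      with 1 show ?thesis
        by (intro exI[of _ b]) (auto simp: solutions_def)
    next
      case 2
      then have "y ^ 2 = [:- \<eta>:]"
        using v' by (simp add: power2_eq_square minus_equation_iff[of "y * y"])
      then obtain b where b: "y = [:b:]" "b ^ 2 = - \<eta>"
        using sqrt_const_poly by metis
      have "b ^ 4 = \<eta> ^ 2"
        using b(2) by algebra
      with 2 b show ?thesis
        by (intro exI[of _ b]) (auto simp: solutions_def)
    qed
  next
    case 2
    then have "x ^ 2 - y ^ 2 = [:\<eta>:]"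
      using u by simp
    from diff_squares_eq_const[OF this \<eta>] have "degree (x * y) = 0"
      by (auto elim!: degree_eq_zeroE)
    then show ?thesis
      using 2 l \<eta> unfolding v by simp
  next
    case 3
    \<comment> \<open>With \<open>k\<close> absorbing the leading constant, (x + i y)^2 and
      \<open>q ^ 2\<close> differ by a nonzero constant. This forces \<open>q\<close> to be constant
      although \<open>l\<close> is not.\<close>
    obtain k where k: "k ^ 2 = 2 * \<i> * \<eta>"
      by (metis power2_csqrt)
    define a where "a = [:- (\<i> / 4):]"
    define q where "q = [:k:] * (l + a)"
    have cheb: "cheb l (Suc n) = l ^ 2 - 1" "cheb l n = l"
      using 3 by (simp_all add: numeral_2_eq_2)
    text \<open>Completing the square: \<open>S\<^sub>3 - (i / 2) S\<^sub>2 = (\<lambda> - i / 4)\<^sup>2 - 15 / 16\<close>.\<close>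
    have "(x + J * y) ^ 2 = [:k ^ 2:] * (l ^ 2 + [:- (\<i> / 2):] * l - 1)"
      using p cheb unfolding k[symmetric] K_def by (simp add: algebra_simps)
    moreover have "[:- (\<i> / 2):] = 2 * a"
      by (simp add: a_def numeral_poly)
    moreover have "q ^ 2 = [:k ^ 2:] * (l + a) ^ 2"
      unfolding q_def power_mult_distrib by (simp add: power2_eq_square)
    ultimately have "(x + J * y) ^ 2 - q ^ 2 = - [:k ^ 2:] * (1 + a ^ 2)"
      by algebra
    also have "\<dots> = [:- (15 / 16) * k ^ 2:]"
      by (simp add: a_def power2_eq_square one_pCons)
    finally have "(x + J * y) ^ 2 - q ^ 2 = [:- (15 / 16) * k ^ 2:]" .
    moreover have "k \<noteq> 0"
      using k \<eta> by auto
    ultimately have "degree q = 0"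
      using diff_squares_eq_const(2) by (metis (no_types) divide_eq_0_iff mult_eq_0_iff neg_equal_0_iff_equal power_not_zero zero_neq_numeral)
    then show ?thesis
      using l \<open>k \<noteq> 0\<close> by (simp add: q_def a_def degree_add_eq_left)
  qed
qed

section \<open>The solution set\<close>

lemma solutions_sound:
  assumes "(x, y) \<in> solutions l \<zeta>"
  shows "F l x y = [:\<zeta> ^ 4:]"
proof -
  define Z where "Z = [:\<zeta>:]"
  have "[:\<zeta> ^ 4:] = Z ^ 4"
    by (simp add: Z_def poly_const_pow)
  moreover have "(x, y) \<in> {(Z, 0), (0, Z), (Z, Z), (- Z, Z), (Z * l, Z), (- Z, Z * l)}"
    using assms by (simp add: solutions_def Z_def)
  ultimately show ?thesis
    by (auto simp: F_expand) (simp_all add: algebra_simps power2_eq_square power3_eq_cube power4_eq_xxxx)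
qed

text \<open>The Pell form is symmetric in \<open>u\<close> and \<open>v\<close>, so the one of
  larger degree may be put first.\<close>

lemma solutions_complete:
  assumes l: "degree l > 0" and \<xi>: "\<xi> \<noteq> 0" and F: "F l x y = [:\<xi>:]"
  shows "\<exists>\<zeta>. \<zeta> ^ 4 = \<xi> \<and> (x, y) \<in> solutions l \<zeta>"
proof -
  define u v where "u = x ^ 2 - y ^ 2" and "v = x * y"
  have eq: "u ^ 2 - l * u * v + v ^ 2 = [:\<xi>:]" "v ^ 2 - l * v * u + u ^ 2 = [:\<xi>:]"
    using F by (simp_all add: F_eq_pell u_def v_def algebra_simps)
  \<comment> \<open>The exceptional Pell solution is the pair of terms with indices 0 and 1 in
    swapped order.\<close>
  have zero: "r = 0 \<and> s = [:\<eta>:] \<Longrightarrow> r = [:\<eta>:] * cheb l 0 \<and> s = [:\<eta>:] * cheb l (Suc 0)" for r s \<eta>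
    by simp
  have "\<exists>\<eta> n. \<eta> ^ 2 = \<xi> \<and> (u = [:\<eta>:] * cheb l (Suc n) \<and> v = [:\<eta>:] * cheb l n \<or>
      u = [:\<eta>:] * cheb l n \<and> v = [:\<eta>:] * cheb l (Suc n))"
  proof (cases "degree v \<le> degree u")
    case True
    then show ?thesis
      using pell_solutions[OF l eq(1)] zero by blast
  next
    case False
    then show ?thesis
      using pell_solutions[OF l eq(2)] zero by (meson nle_le)
  qed
  then obtain \<eta> n where \<eta>: "\<eta> ^ 2 = \<xi>" and "u = [:\<eta>:] * cheb l (Suc n) \<and> v = [:\<eta>:] * cheb l n \<or>
      u = [:\<eta>:] * cheb l n \<and> v = [:\<eta>:] * cheb l (Suc n)"
    by blast
  moreover have "\<eta> \<noteq> 0"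
    using \<eta> \<xi> by auto
  ultimately show ?thesis
    using solutions_larger_first[OF l, of \<eta> x y n] solutions_larger_second[OF l, of \<eta> x y n]
    unfolding u_def v_def by blast
qed

theorem theorem1p1:
  fixes \<xi> :: complex and lam :: "complex poly"
  assumes "\<xi> \<noteq> 0"
    and "lam \<notin> range (\<lambda>c. [:c:])"
  shows "{(x, y). F lam x y = [:\<xi>:]} =
    (\<Union>\<zeta>\<in>{\<zeta>. \<zeta> \<noteq> 0 \<and> \<zeta> ^ 4 = \<xi>}.
      {([:\<zeta>:], 0), (0, [:\<zeta>:]), ([:\<zeta>:], [:\<zeta>:]), (- [:\<zeta>:], [:\<zeta>:]),
       ([:\<zeta>:] * lam, [:\<zeta>:]), (- [:\<zeta>:], [:\<zeta>:] * lam)})"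
proof -
  have "degree lam > 0"
    using assms(2) by (metis degree_eq_zeroE neq0_conv rangeI)
  then have "F lam x y = [:\<xi>:] \<longleftrightarrow> (\<exists>\<zeta>. \<zeta> \<noteq> 0 \<and> \<zeta> ^ 4 = \<xi> \<and> (x, y) \<in> solutions lam \<zeta>)" for x y
    using solutions_complete[of lam \<xi> x y] solutions_sound[of x y lam] assms(1)
    by (metis zero_power zero_less_numeral)
  then show ?thesis
    unfolding solutions_def[symmetric] by auto
qed

end
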